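(* Let $M=(E,\mathcal{I})$ be a Hamiltonian matroid with $\chi(M)\leqslant 2$. Suppose that two agents have the same monotone valuation $v\colon 2^E\to\mathbb{R}_{\geqslant 0}$. Then there exists an EF1 partition $E=A\cup B$ into two independent sets of $M$ whose sizes differ by at most $1$.
   Context: A matroid $M=(E,\mathcal{I})$ has a finite ground set $E$, family of independent sets $\mathcal{I}$, and rank $r(M)$. The chromatic number $\chi(M)$ is the least number of parts in a partition of $E$ into independent sets. The matroid $M$ is called Hamiltonian if there exists a cyclic ordering of $E$ such that every segment of $r(M)$ cyclically consecutive elements forms a basis of $M$. A valuation $v\colon 2^E\to\mathbb{R}_{\geqslant 0}$ is monotone if $v(X)\leqslant v(Y)$ whenever $X\subseteq Y\subseteq E$. A partition into two bundles is an ordered pair of disjoint, possibly empty, sets with union $E$. For two agents with the common monotone valuation $v$, a partition $(X_1,X_2)$ of $E$ is EF1 if for all $i\neq j$ in $\{1,2\}$: either $X_j=\emptyset$, or there exists a good $g\in X_j$ such that $v(X_i)\geqslant v(X_j\setminus\{g\})$. *)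

theory Defs
  imports Complex_Main "HOL-Library.Disjoint_Sets" "HOL-Library.Extended_Nat"
begin

locale matroid =
  fixes E :: "'a set" and \<I> :: "'a set set"
  assumes finite_ground: "finite E"
    and indep_subset_ground: "X \<in> \<I> \<Longrightarrow> X \<subseteq> E"
    and indep_empty: "{} \<in> \<I>"
    and indep_mono: "Y \<in> \<I> \<Longrightarrow> X \<subseteq> Y \<Longrightarrow> X \<in> \<I>"
    and indep_augment:
      "X \<in> \<I> \<Longrightarrow> Y \<in> \<I> \<Longrightarrow> card X < card Y \<Longrightarrow> \<exists>y\<in>Y - X. insert y X \<in> \<I>"

definition matroid_rank :: "'a set set \<Rightarrow> nat" where
  "matroid_rank \<I> = Max (card ` \<I>)"

definition matroid_basis :: "'a set set \<Rightarrow> 'a set \<Rightarrow> bool" where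
  "matroid_basis \<I> B \<longleftrightarrow> B \<in> \<I> \<and> (\<forall>X\<in>\<I>. B \<subseteq> X \<longrightarrow> X = B)"

text \<open>The chromatic number is \<open>\<infinity>\<close> when no partition into independent sets exists,
  that is, when the matroid has a loop. For finite \<open>E\<close> every partition is a finite family,
  so \<open>card P\<close> is the true number of parts.\<close>

definition chromatic_number :: "'a set \<Rightarrow> 'a set set \<Rightarrow> enat" where
  "chromatic_number E \<I> = (INF P \<in> {P. partition_on E P \<and> P \<subseteq> \<I>}. enat (card P))"

text \<open>A cyclic ordering of \<open>E\<close> is represented by a duplicate-free list enumerating \<open>E\<close>; the
  cyclic segment of length \<open>r\<close> starting at position \<open>i\<close> is the length-\<open>r\<close> prefix of its
  \<open>i\<close>-th rotation.\<close>

definition hamiltonian :: "'a set \<Rightarrow> 'a set set \<Rightarrow> bool" where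
  "hamiltonian E \<I> \<longleftrightarrow> (\<exists>xs. distinct xs \<and> set xs = E \<and>
     (\<forall>i. matroid_basis \<I> (set (take (matroid_rank \<I>) (rotate i xs)))))"

definition monotone_valuation :: "'a set \<Rightarrow> ('a set \<Rightarrow> real) \<Rightarrow> bool" where
  "monotone_valuation E v \<longleftrightarrow>
     (\<forall>X. X \<subseteq> E \<longrightarrow> 0 \<le> v X) \<and> (\<forall>X Y. X \<subseteq> Y \<longrightarrow> Y \<subseteq> E \<longrightarrow> v X \<le> v Y)"

definition bundle_partition :: "'a set \<Rightarrow> 'a set \<Rightarrow> 'a set \<Rightarrow> bool" where
  "bundle_partition E A B \<longleftrightarrow> A \<inter> B = {} \<and> A \<union> B = E"

text \<open>\<open>envy_free_up_to_one v X Y\<close>: an agent with valuation \<open>v\<close> who holds \<open>X\<close> does not envy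
  \<open>Y\<close> up to the removal of one good.\<close>

definition envy_free_up_to_one :: "('a set \<Rightarrow> real) \<Rightarrow> 'a set \<Rightarrow> 'a set \<Rightarrow> bool" where
  "envy_free_up_to_one v X Y \<longleftrightarrow> Y = {} \<or> (\<exists>g\<in>Y. v X \<ge> v (Y - {g}))"

definition EF1_partition :: "'a set \<Rightarrow> ('a set \<Rightarrow> real) \<Rightarrow> 'a set \<Rightarrow> 'a set \<Rightarrow> bool" where
  "EF1_partition E v A B \<longleftrightarrow> bundle_partition E A B \<and>
     envy_free_up_to_one v A B \<and> envy_free_up_to_one v B A"

end

theory Submission
  imports Defs
begin

text \<open>
  Covering the ground set by at most two independent sets gives \<open>n \<le> 2 r\<close> for \<open>n = card E\<close> and \<open>r\<close> the rank, so
  half of \<open>E\<close>, rounded either way, has at most \<open>r\<close> elements. Along a Hamiltonian cyclic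
  ordering every segment of at most \<open>r\<close> consecutive elements is independent, hence every cut of
  the cycle into two nearly equal arcs is an admissible partition. It remains to find an EF1
  partition among these cuts.

  Rotating such a cut by half a turn exchanges the two arcs. During the rotation the more
  valuable arc therefore becomes the less valuable one, and there are two successive cuts between
  which the comparison changes. The rotation can be done in steps that pass at most one good in
  each direction (lemma \<open>ex_EF1_in_reversing_sequence\<close>). One of the two cuts at the
  change must be EF1: if neither is, then with \<open>C\<close> and \<open>D\<close> the parts of the two bundles that
  do not move, the bundle containing \<open>D\<close> is worth less than \<open>C\<close> before the step, and the
  bundle containing \<open>C\<close> is worth less than \<open>D\<close> after it. Monotonicity makes that impossible
  (lemma \<open>EF1_at_crossing\<close>).
\<close>

section \<open>EF1 at a change of preference\<close>

lemma EF1_partition_commute: "EF1_partition E v A B \<longleftrightarrow> EF1_partition E v B A"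
  unfolding EF1_partition_def bundle_partition_def by blast

lemma EF1_partition_if_prefers:
  assumes v: "monotone_valuation E v" and "bundle_partition E A B"
    and "v B \<le> v A" and "envy_free_up_to_one v B A"
  shows "EF1_partition E v A B"
proof -
  have "v (B - {g}) \<le> v A" for g
  proof -
    have "v (B - {g}) \<le> v B"
      using v assms(2) unfolding monotone_valuation_def bundle_partition_def by blast
    then show ?thesis using assms(3) by linarith
  qed
  then show ?thesis
    using assms unfolding EF1_partition_def envy_free_up_to_one_def by blast
qed

text \<open>If a bundle \<open>A\<close> exceeds \<open>C\<close> by at most one good, removing that good (or any good, if there is
  no excess) leaves a subset of \<open>C\<close>, so whoever values their own bundle at least as much as
  \<open>C\<close> has no envy beyond one good.\<close>

lemma envy_free_up_to_one_if_almost_subset: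
  assumes v: "monotone_valuation E v" and "C \<subseteq> E" and "A - {a} \<subseteq> C" and "v C \<le> v B"
  shows "envy_free_up_to_one v B (A :: 'a set)"
proof (cases "A = {}")
  case False
  obtain g where "g \<in> A" "A - {g} \<subseteq> C"
    using False assms(3) by (cases "a \<in> A") auto
  moreover from this have "v (A - {g}) \<le> v C"
    using v assms(2) unfolding monotone_valuation_def by blast
  ultimately show ?thesis
    using assms(4) unfolding envy_free_up_to_one_def by force
qed (simp add: envy_free_up_to_one_def)

text \<open>The good \<open>a\<close> is the only one that may leave the first bundle and \<open>b\<close> the only one that may
  enter it. Bounding the movement instead of prescribing it covers swaps, one-sided
  transfers and standing still alike.\<close>

lemma EF1_at_crossing:
  fixes E :: "'a set"
  assumes v: "monotone_valuation E v" and sub: "A \<subseteq> E" "A' \<subseteq> E"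
    and moves: "A - A' \<subseteq> {a}" "A' - A \<subseteq> {b}"
    and before: "v (E - A) \<le> v A" and after: "v A' \<le> v (E - A')"
  shows "EF1_partition E v A (E - A) \<or> EF1_partition E v A' (E - A')"
proof -
  define C where "C = A \<inter> A'"
  define D where "D = E - (A \<union> A')"
  have CD: "C \<subseteq> E" "D \<subseteq> E" "A - {a} \<subseteq> C" "(E - A') - {a} \<subseteq> D"
    using sub moves by (auto simp: C_def D_def)
  have mono: "v C \<le> v A'" "v D \<le> v (E - A)"
    using v sub unfolding monotone_valuation_def C_def D_def
    by (meson Diff_mono Diff_subset Int_lower2 Un_upper1 order_refl)+
  (* Otherwise v D \<le> v (E - A) < v C \<le> v A' < v D. *)
  consider "v C \<le> v (E - A)" | "v D \<le> v A'"
    using mono by linarith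
  then show ?thesis
  proof cases
    case 1
    have "envy_free_up_to_one v (E - A) A"
      using envy_free_up_to_one_if_almost_subset[OF v CD(1,3) 1] .
    then show ?thesis
      using EF1_partition_if_prefers[OF v _ before] sub
      by (auto simp: bundle_partition_def)
  next
    case 2
    have "envy_free_up_to_one v A' (E - A')"
      using envy_free_up_to_one_if_almost_subset[OF v CD(2,4) 2] .
    then have "EF1_partition E v (E - A') A'"
      using EF1_partition_if_prefers[OF v _ after] sub
      by (auto simp: bundle_partition_def)
    then show ?thesis
      using EF1_partition_commute by blast
  qed
qed

text \<open>A discrete intermediate value argument: the first index at which the first bundle is no longer
  strictly preferred exists, because the reversal at index \<open>N\<close> exchanges the two values.\<close>

lemma ex_EF1_in_reversing_sequence_if_prefers:
  fixes E :: "'a set"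
  assumes v: "monotone_valuation E v" and sub: "\<And>j. j \<le> N \<Longrightarrow> X j \<subseteq> E"
    and moves: "\<And>j. j < N \<Longrightarrow> \<exists>a. X j - X (Suc j) \<subseteq> {a}"
      "\<And>j. j < N \<Longrightarrow> \<exists>b. X (Suc j) - X j \<subseteq> {b}"
    and reversed: "X N = E - X 0"
    and start: "v (E - X 0) \<le> v (X 0)"
  shows "\<exists>j\<le>N. EF1_partition E v (X j) (E - X j)"
proof -
  define j where "j = (LEAST j. v (X j) \<le> v (E - X j))"
  have "E - (E - X 0) = X 0" using sub[of 0] by auto
  then have N: "v (X N) \<le> v (E - X N)" using reversed start by simp
  have j: "v (X j) \<le> v (E - X j)" "j \<le> N"
    unfolding j_def
    using LeastI[of "\<lambda>j. v (X j) \<le> v (E - X j)", OF N]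
      Least_le[of "\<lambda>j. v (X j) \<le> v (E - X j)", OF N] by auto
  show ?thesis
  proof (cases j)
    case 0
    (* Both values agree, so the crossing happens without any good moving. *)
    have "EF1_partition E v (X 0) (E - X 0) \<or> EF1_partition E v (X 0) (E - X 0)"
      by (rule EF1_at_crossing[OF v]) (use sub[of 0] start j 0 in auto)
    then show ?thesis by auto
  next
    case (Suc i)
    then have i: "v (E - X i) \<le> v (X i)"
      using not_less_Least[of i "\<lambda>j. v (X j) \<le> v (E - X j)"] unfolding j_def by simp
    have "i < N" using Suc j(2) by simp
    then obtain a b where "X i - X (Suc i) \<subseteq> {a}" "X (Suc i) - X i \<subseteq> {b}"
      using moves by blast
    then have "EF1_partition E v (X i) (E - X i) \<or>
        EF1_partition E v (X (Suc i)) (E - X (Suc i))"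
      using EF1_at_crossing[OF v] sub[of i] sub[of "Suc i"] i j(1) \<open>i < N\<close> Suc by simp
    then show ?thesis
      using \<open>i < N\<close> by (meson Suc_leI less_imp_le)
  qed
qed

text \<open>If the second bundle is preferred at the start, the sequence of complements, which passes the
  same goods in the opposite directions, starts from the preferred side.\<close>

lemma ex_EF1_in_reversing_sequence:
  fixes E :: "'a set"
  assumes v: "monotone_valuation E v" and sub: "\<And>j. j \<le> N \<Longrightarrow> X j \<subseteq> E"
    and moves: "\<And>j. j < N \<Longrightarrow> \<exists>a. X j - X (Suc j) \<subseteq> {a}"
      "\<And>j. j < N \<Longrightarrow> \<exists>b. X (Suc j) - X j \<subseteq> {b}"
    and reversed: "X N = E - X 0"
  shows "\<exists>j\<le>N. EF1_partition E v (X j) (E - X j)"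
proof (cases "v (E - X 0) \<le> v (X 0)")
  case True
  then show ?thesis
    using ex_EF1_in_reversing_sequence_if_prefers[of E v N X] assms by blast
next
  case False
  have dbl: "E - (E - X j) = X j" if "j \<le> N" for j
    using sub[OF that] by auto
  have "\<exists>j\<le>N. EF1_partition E v (E - X j) (E - (E - X j))"
  proof (rule ex_EF1_in_reversing_sequence_if_prefers[OF v])
    show "\<exists>a. (E - X j) - (E - X (Suc j)) \<subseteq> {a}" if "j < N" for j
      using moves(2)[OF that] by blast
    show "\<exists>b. (E - X (Suc j)) - (E - X j) \<subseteq> {b}" if "j < N" for j
      using moves(1)[OF that] by blast
  qed (use reversed False dbl[of 0] in auto)
  then show ?thesis
    using dbl EF1_partition_commute by metis
qed

section \<open>The rank and the chromatic number\<close>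

lemma (in matroid) finite_indep: "finite \<I>"
  by (rule finite_subset[of _ "Pow E"]) (use indep_subset_ground finite_ground in auto)

lemma (in matroid) card_indep_le_rank: "X \<in> \<I> \<Longrightarrow> card X \<le> matroid_rank \<I>"
  unfolding matroid_rank_def using finite_indep by (intro Max_ge) auto

text \<open>An infimum of extended naturals below \<open>\<infinity>\<close> is attained, so there is a partition into at most \<open>k\<close>
  independent sets, each of which has at most rank many elements.\<close>

lemma (in matroid) card_ground_le_chromatic_times_rank:
  assumes "chromatic_number E \<I> \<le> enat k"
  shows "card E \<le> k * matroid_rank \<I>"
proof -
  have "chromatic_number E \<I> < enat (Suc k)"
    using assms by (rule order.strict_trans1) simp
  then obtain P where P: "partition_on E P" "P \<subseteq> \<I>" "card P < Suc k"
    unfolding chromatic_number_def by (auto simp: Inf_less_iff)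
  have "card E = card (\<Union>P)"
    using P(1) by (simp add: partition_on_def)
  also have "\<dots> \<le> (\<Sum>X\<in>P. card X)"
    by (rule card_Union_le_sum_card)
  also have "\<dots> \<le> (\<Sum>X\<in>P. matroid_rank \<I>)"
    using P(2) card_indep_le_rank by (intro sum_mono) auto
  also have "\<dots> \<le> k * matroid_rank \<I>"
    using P(3) by simp
  finally show ?thesis .
qed

section \<open>Arcs of a Hamiltonian ordering\<close>

lemma rotate_eq_drop_append_take:
  "q \<le> length xs \<Longrightarrow> rotate q xs = drop q xs @ take q xs"
  using rotate_append[of "take q xs" "drop q xs"] by simp

lemma indep_arc:
  assumes "matroid E \<I>"
    and bases: "\<And>i. matroid_basis \<I> (set (take (matroid_rank \<I>) (rotate i xs)))"
    and "m \<le> matroid_rank \<I>"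
  shows "set (take m (rotate i xs)) \<in> \<I>"
proof -
  have "set (take m (rotate i xs)) \<subseteq> set (take (matroid_rank \<I>) (rotate i xs))"
    using assms(3) by (rule set_take_subset_set_take)
  then show ?thesis
    using bases[of i] matroid.indep_mono[OF assms(1)] unfolding matroid_basis_def by blast
qed

text \<open>Cutting a list at two positions \<open>p \<le> q\<close>, the inner part is an arc starting at \<open>p\<close> and the outer
  part wraps around the end and is an arc starting at \<open>q\<close>.\<close>

lemma inner_arc:
  assumes "p \<le> q" "q \<le> length xs"
  shows "set (take (q - p) (rotate p xs)) = (!) xs ` {p..<q}"
proof -
  have "take (q - p) (rotate p xs) = take (q - p) (drop p xs)"
    using assms by (simp add: rotate_eq_drop_append_take)
  also have "\<dots> = map ((!) xs) [p..<q]"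
    using assms by (intro nth_equalityI) auto
  finally show ?thesis by simp
qed

lemma outer_arc:
  assumes "p \<le> q" "q \<le> length xs" "distinct xs"
  shows "set (take (length xs - q + p) (rotate q xs)) = set xs - (!) xs ` {p..<q}"
proof -
  have "set (take (length xs - q + p) (rotate q xs)) = set (take p xs) \<union> set (drop q xs)"
    using assms by (auto simp: rotate_eq_drop_append_take min_def)
  also have "\<dots> = (!) xs ` ({..<p} \<union> {q..<length xs})"
  proof -
    have "take p xs = map ((!) xs) [0..<p]" "drop q xs = map ((!) xs) [q..<length xs]"
      using assms by (auto intro!: nth_equalityI)
    then show ?thesis by (auto simp: image_Un)
  qed
  also have "{..<p} \<union> {q..<length xs} = {..<length xs} - {p..<q}"
    using assms by auto
  also have "(!) xs ` \<dots> = (!) xs ` {..<length xs} - (!) xs ` {p..<q}"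
    using assms by (intro inj_on_image_set_diff[of _ "{..<length xs}"]) (auto intro: inj_on_nth)
  also have "(!) xs ` {..<length xs} = set xs"
    by (auto simp: set_conv_nth)
  finally show ?thesis .
qed

theorem theorem2:
  fixes E :: "'a set" and \<I> :: "'a set set" and v :: "'a set \<Rightarrow> real"
  assumes "matroid E \<I>"
    and "hamiltonian E \<I>"
    and "chromatic_number E \<I> \<le> 2"
    and "monotone_valuation E v"
  shows "\<exists>A B. EF1_partition E v A B \<and> A \<in> \<I> \<and> B \<in> \<I> \<and>
           \<bar>int (card A) - int (card B)\<bar> \<le> 1"
proof -
  interpret matroid E \<I> by fact
  obtain xs where xs: "distinct xs" "set xs = E"
    and bases: "\<And>i. matroid_basis \<I> (set (take (matroid_rank \<I>) (rotate i xs)))"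
    using assms(2) unfolding hamiltonian_def by blast
  define n where "n = length xs"
  have "chromatic_number E \<I> \<le> enat 2"
    using assms(3) by (simp add: numeral_eq_enat)
  then have "card E \<le> 2 * matroid_rank \<I>"
    by (rule card_ground_le_chromatic_times_rank)
  then have n_le: "n \<le> 2 * matroid_rank \<I>"
    using xs distinct_card unfolding n_def by fastforce
  (* Halving j + n next to j handles both parities: for even n both ends of the arc advance
     together in every other step, for odd n they advance alternately. After n steps the initial
     arc {0..<n div 2} has become {n div 2..<n}, and no index
     ever wraps around. *)
  define p q where "p j = j div 2" and "q j = (j + n) div 2" for j
  define X where "X j = (!) xs ` {p j..<q j}" for j
  have pq: "p j \<le> q j" "q j \<le> length xs" if "j \<le> n" for j
    using that by (auto simp: p_def q_def n_def)
  have X_inner: "X j = set (take (q j - p j) (rotate (p j) xs))" if "j \<le> n" for j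
    using inner_arc[OF pq[OF that]] by (simp add: X_def)
  have X_outer: "E - X j = set (take (length xs - q j + p j) (rotate (q j) xs))"
    if "j \<le> n" for j
    using outer_arc[OF pq[OF that] xs(1)] xs(2) by (simp add: X_def)
  have "\<exists>j\<le>n. EF1_partition E v (X j) (E - X j)"
  proof (rule ex_EF1_in_reversing_sequence[OF assms(4)])
    show "X j \<subseteq> E" if "j \<le> n" for j
      using pq[OF that] xs(2) by (auto simp: X_def)
    show "\<exists>a. X j - X (Suc j) \<subseteq> {a}" for j
    proof -
      have "{p j..<q j} - {p (Suc j)..<q (Suc j)} \<subseteq> {p j}"
        by (auto simp: p_def q_def)
      then have "X j - X (Suc j) \<subseteq> {xs ! p j}" by (auto simp: X_def)
      then show ?thesis ..
    qed
    show "\<exists>b. X (Suc j) - X j \<subseteq> {b}" for j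
    proof -
      have "{p (Suc j)..<q (Suc j)} - {p j..<q j} \<subseteq> {q j}"
        by (auto simp: p_def q_def)
      then have "X (Suc j) - X j \<subseteq> {xs ! q j}" by (auto simp: X_def)
      then show ?thesis ..
    qed
    have "X n = (!) xs ` {n div 2..<n}" "X 0 = (!) xs ` {0..<n div 2}"
      by (simp_all add: X_def p_def q_def)
    moreover have "E - X 0 = set (drop (n div 2) xs)"
      using X_outer[of 0] by (simp add: p_def q_def n_def rotate_eq_drop_append_take)
    moreover have "set (drop (n div 2) xs) = (!) xs ` {n div 2..<n}"
    proof -
      have "drop (n div 2) xs = map ((!) xs) [n div 2..<n]"
        by (auto simp: n_def intro!: nth_equalityI)
      then show ?thesis by simp
    qed
    ultimately show "X n = E - X 0" by simp
  qed
  then obtain j where j: "j \<le> n" and EF1: "EF1_partition E v (X j) (E - X j)"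
    by blast
  have sizes: "q j - p j \<le> matroid_rank \<I>" "length xs - q j + p j \<le> matroid_rank \<I>"
    using j n_le by (auto simp: p_def q_def n_def)
  have indep: "X j \<in> \<I>" "E - X j \<in> \<I>"
    using indep_arc[OF assms(1) bases] sizes X_inner[OF j] X_outer[OF j] by simp_all
  have "card (X j) = q j - p j"
    unfolding X_inner[OF j] using pq[OF j] xs(1) by (simp add: distinct_card)
  moreover have "card (E - X j) = length xs - q j + p j"
    unfolding X_outer[OF j] using pq[OF j] xs(1) by (simp add: distinct_card)
  ultimately have "\<bar>int (card (X j)) - int (card (E - X j))\<bar> \<le> 1"
    using j by (simp add: p_def q_def n_def) linarith
  then show ?thesis
    using EF1 indep by blast
qed

end
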